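(* Let $\mathbb{F}_q$ be a finite field with $q$ elements and let $L$ be a three-dimensional Lie algebra over $\mathbb{F}_q$ with $\dim L'=2$. Put $V=L'$ and suppose that for some $x\in L\setminus L'$ the restriction $\operatorname{ad} x|_V : V\to V$ has a unique eigenvalue (lying in $\mathbb{F}_q$) and is non-diagonalisable over $\mathbb{F}_q$. Then the number of triangles in the comaximal graph $\Gamma(L)$ is $$\mathfrak{t}(\Gamma(L)) = \frac{q(q-1)(q+1)^4}{6}.$$
   Context: For a finite-dimensional Lie algebra $L$, $L'=[L,L]$ is the derived algebra. The comaximal graph $\Gamma(L)$ is the simple undirected graph whose vertices are the proper nonzero Lie subalgebras of $L$; two distinct vertices $A,B$ are adjacent if and only if the Lie subalgebra $\langle A,B\rangle$ generated by $A\cup B$ equals $L$. A triangle of a graph is a set of three pairwise adjacent vertices, and $\mathfrak{t}(\Gamma)$ denotes the number of triangles of $\Gamma$. *)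

theory Defs
  imports Complex_Main "HOL-Library.Cardinality"
begin

section \<open>Lie algebras\<close>

text \<open>The alternating law is stated as \<open>[x, x] = 0\<close> rather than as antisymmetry,
  which would be too weak in characteristic 2.\<close>

locale lie_algebra = vector_space scale
  for scale :: "'a::field \<Rightarrow> 'b::ab_group_add \<Rightarrow> 'b" +
  fixes bracket :: "'b \<Rightarrow> 'b \<Rightarrow> 'b"
  assumes bracket_add_left: "bracket (x + y) z = bracket x z + bracket y z"
    and bracket_add_right: "bracket x (y + z) = bracket x y + bracket x z"
    and bracket_scale_left: "bracket (scale c x) y = scale c (bracket x y)"
    and bracket_scale_right: "bracket x (scale c y) = scale c (bracket x y)"
    and bracket_self: "bracket x x = 0"
    and jacobi: "bracket x (bracket y z) + bracket y (bracket z x) + bracket z (bracket x y) = 0"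
begin

definition ad :: "'b \<Rightarrow> 'b \<Rightarrow> 'b" where
  "ad x = (\<lambda>y. bracket x y)"

definition derived_algebra :: "'b set" where
  "derived_algebra = span {bracket x y | x y. True}"

definition lie_subalgebra :: "'b set \<Rightarrow> bool" where
  "lie_subalgebra A \<longleftrightarrow> subspace A \<and> (\<forall>x\<in>A. \<forall>y\<in>A. bracket x y \<in> A)"

definition lie_generated :: "'b set \<Rightarrow> 'b set" where
  "lie_generated X = lie_subalgebra hull X"

lemma lie_subalgebra_generated: "lie_subalgebra (lie_generated X)"
  unfolding lie_generated_def
  by (rule hull_in) (auto simp: lie_subalgebra_def intro: subspace_Inter)

lemma ad_derived_algebra: "ad x y \<in> derived_algebra"
  unfolding ad_def derived_algebra_def by (rule span_base) auto

end

section \<open>Eigenvalues and diagonalisability of an operator on an invariant subspace\<close>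

context vector_space
begin

text \<open>In the following two definitions \<open>V\<close> is meant to be a subspace with \<open>f ` V \<subseteq> V\<close>;
  they then speak about the restriction of \<open>f\<close> to an endomorphism of \<open>V\<close>.\<close>

definition eigenvalue_on :: "'b set \<Rightarrow> ('b \<Rightarrow> 'b) \<Rightarrow> 'a \<Rightarrow> bool" where
  "eigenvalue_on V f c \<longleftrightarrow> (\<exists>v\<in>V. v \<noteq> 0 \<and> f v = scale c v)"

definition diagonalisable_on :: "'b set \<Rightarrow> ('b \<Rightarrow> 'b) \<Rightarrow> bool" where
  "diagonalisable_on V f \<longleftrightarrow>
     (\<exists>B. independent B \<and> span B = V \<and> (\<forall>b\<in>B. \<exists>c. f b = scale c b))"

end

section \<open>Simple graphs and triangles\<close>

text \<open>A simple undirected graph is a pair of a vertex set and a set of edges, each edge being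
  a two-element set of vertices.\<close>

type_synonym 'v sgraph = "'v set \<times> 'v set set"

definition simple_graph :: "'v sgraph \<Rightarrow> bool" where
  "simple_graph G \<longleftrightarrow> (\<forall>e\<in>snd G. e \<subseteq> fst G \<and> card e = 2)"

definition triangles :: "'v sgraph \<Rightarrow> 'v set set" where
  "triangles G = {T. T \<subseteq> fst G \<and> card T = 3 \<and> (\<forall>u\<in>T. \<forall>v\<in>T. u \<noteq> v \<longrightarrow> {u, v} \<in> snd G)}"

definition num_triangles :: "'v sgraph \<Rightarrow> nat" where
  "num_triangles G = card (triangles G)"

section \<open>The comaximal graph\<close>

context lie_algebra
begin

definition comaximal_vertices :: "'b set set" where
  "comaximal_vertices = {A. lie_subalgebra A \<and> A \<noteq> {0} \<and> A \<noteq> UNIV}"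

definition comaximal_graph :: "'b set sgraph" where
  "comaximal_graph =
     (comaximal_vertices,
      {{A, B} | A B. A \<in> comaximal_vertices \<and> B \<in> comaximal_vertices \<and> A \<noteq> B
         \<and> lie_generated (A \<union> B) = UNIV})"

lemma simple_graph_comaximal_graph: "simple_graph comaximal_graph"
  by (auto simp: simple_graph_def comaximal_graph_def card_2_iff)

end

end

(* Since V is abelian, a plane is a subalgebra if and only if it contains the eigenline E of ad x
   on V. So E is an isolated vertex of the comaximal graph, and to any other vertex A belongs
   exactly one plane A + E through E. Two such vertices A, B generate L if and only if
   A + E and B + E differ: a proper subalgebra containing both is either a line or contains E.
   There are q + 1 planes through E, each of them arising from q + 1 vertices (itself and its q
   lines other than E), so outside E the graph is complete (q + 1)-partite with parts of size
   q + 1, and the number of triangles is binomial(q + 1, 3) (q + 1)^3. *)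

theory Submission
  imports Defs "HOL-Library.FuncSet"
begin

section \<open>Triangles in complete multipartite graphs\<close>

text \<open>A transversal is the image of exactly one choice function on the fibres: its value at
  \<open>s\<close> must be the only element of \<open>T\<close> that \<open>p\<close> sends to
  \<open>s\<close>. So the transversals correspond to the product of \<open>card S\<close> fibres of
  size \<open>k\<close>.\<close>

lemma card_transversals:
  assumes "finite S" and fibre: "\<And>s. s \<in> S \<Longrightarrow> card {a \<in> X. p a = s} = k"
  shows "card {T. T \<subseteq> X \<and> inj_on p T \<and> p ` T = S} = k ^ card S"
proof -
  let ?F = "\<lambda>s. {a \<in> X. p a = s}"
  have "bij_betw (\<lambda>g. g ` S) (Pi\<^sub>E S ?F) {T. T \<subseteq> X \<and> inj_on p T \<and> p ` T = S}"
    unfolding bij_betw_def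
  proof (intro conjI set_eqI iffI)
    show "inj_on (\<lambda>g. g ` S) (Pi\<^sub>E S ?F)"
    proof (rule inj_onI)
      fix g h assume g: "g \<in> Pi\<^sub>E S ?F" and h: "h \<in> Pi\<^sub>E S ?F" and eq: "g ` S = h ` S"
      show "g = h"
      proof (rule PiE_ext[OF g h])
        fix s assume s: "s \<in> S"
        then obtain s' where s': "s' \<in> S" "g s = h s'" using eq by blast
        have "p (g s) = s" "p (h s') = s'" using s s' g h by (auto simp: PiE_iff)
        then show "g s = h s" using s' by simp
      qed
    qed
  next
    fix T assume "T \<in> (\<lambda>g. g ` S) ` (Pi\<^sub>E S ?F)"
    then obtain g where g: "g \<in> Pi\<^sub>E S ?F" "T = g ` S" by blast
    then have "p (g s) = s \<and> g s \<in> X" if "s \<in> S" for s using that by (auto simp: PiE_iff)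
    then show "T \<in> {T. T \<subseteq> X \<and> inj_on p T \<and> p ` T = S}"
      using g(2) by (auto simp: inj_on_def image_image)
  next
    fix T assume "T \<in> {T. T \<subseteq> X \<and> inj_on p T \<and> p ` T = S}"
    then have T: "T \<subseteq> X" "inj_on p T" "p ` T = S" by auto
    \<comment> \<open>Restricting to \<open>S\<close> makes the inverse of \<open>p\<close> on
      \<open>T\<close> extensional, as membership in \<open>Pi\<^sub>E\<close> demands.\<close>
    let ?g = "restrict (inv_into T p) S"
    have "?g \<in> Pi\<^sub>E S ?F" using T by (auto simp: f_inv_into_f inv_into_into subset_iff)
    moreover have "?g ` S = T"
      using T by (auto simp: image_image)
    ultimately show "T \<in> (\<lambda>g. g ` S) ` (Pi\<^sub>E S ?F)" by blast
  qed
  then have "card {T. T \<subseteq> X \<and> inj_on p T \<and> p ` T = S} = card (Pi\<^sub>E S ?F)"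
    by (rule bij_betw_same_card[symmetric])
  also have "\<dots> = k ^ card S" using assms by (simp add: card_PiE)
  finally show ?thesis .
qed

text \<open>The graph is complete multipartite on \<open>X\<close>, with parts the fibres of
  \<open>p\<close>, and vertices outside \<open>X\<close> are isolated. A triangle meets three
  distinct parts in one vertex each, so the triangles over a given triple of parts are its
  transversals.\<close>

lemma num_triangles_multipartite:
  assumes fin: "finite X" and sub: "X \<subseteq> fst G"
    and edges: "\<And>a b. a \<noteq> b \<Longrightarrow> {a, b} \<in> snd G \<longleftrightarrow> a \<in> X \<and> b \<in> X \<and> p a \<noteq> p b"
    and fibre: "\<And>s. s \<in> p ` X \<Longrightarrow> card {a \<in> X. p a = s} = k"
  shows "num_triangles G = (card (p ` X) choose 3) * k ^ 3"
proof -
  let ?S = "{S. S \<subseteq> p ` X \<and> card S = 3}"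
  let ?T = "\<lambda>S. {T. T \<subseteq> X \<and> inj_on p T \<and> p ` T = S}"
  have "triangles G = (\<Union>S\<in>?S. ?T S)"
  proof (intro set_eqI iffI)
    fix T assume "T \<in> triangles G"
    then have c: "card T = 3" and adj: "\<And>u v. u \<in> T \<Longrightarrow> v \<in> T \<Longrightarrow> u \<noteq> v \<Longrightarrow> {u, v} \<in> snd G"
      by (auto simp: triangles_def)
    have "u \<in> X" if "u \<in> T" for u
    proof -
      \<comment> \<open>The edge condition says something about \<open>u\<close> only once a second
        vertex of the triangle is at hand.\<close>
      have "\<not> T \<subseteq> {u}" using c card_mono[of "{u}" T] by auto
      then obtain v where "v \<in> T" "v \<noteq> u" by blast
      then show ?thesis using adj[of u v] edges[of u v] that by blast
    qed
    moreover have "inj_on p T" using adj edges by (meson inj_onI)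
    ultimately show "T \<in> (\<Union>S\<in>?S. ?T S)" using c by (auto simp: card_image)
  next
    fix T assume "T \<in> (\<Union>S\<in>?S. ?T S)"
    then have T: "T \<subseteq> X" "inj_on p T" "card (p ` T) = 3" by auto
    then have "card T = 3" by (simp add: card_image)
    with T show "T \<in> triangles G" using sub edges by (auto simp: triangles_def inj_on_def)
  qed
  moreover have "card (\<Union>S\<in>?S. ?T S) = (\<Sum>S\<in>?S. card (?T S))"
    using fin by (intro card_UN_disjoint) auto
  moreover have "(\<Sum>S\<in>?S. card (?T S)) = (\<Sum>S\<in>?S. k ^ 3)"
  proof (rule sum.cong[OF refl])
    fix S assume S: "S \<in> ?S"
    then have "card (?T S) = k ^ card S"
      using fin fibre by (intro card_transversals) (auto intro: finite_subset)
    then show "card (?T S) = k ^ 3" using S by simp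
  qed
  moreover have "card ?S = card (p ` X) choose 3" using fin by (simp add: n_subsets)
  ultimately show ?thesis by (simp add: num_triangles_def)
qed

section \<open>Counting subspaces\<close>

context vector_space
begin

text \<open>Every element of the span is \<open>scale c y + u\<close> for a unique scalar
  \<open>c\<close> and a unique \<open>u\<close> in \<open>U\<close>: two different scalars would
  allow solving for \<open>y\<close> inside \<open>U\<close>.\<close>

lemma card_span_insert:
  assumes U: "subspace U" and y: "y \<notin> U"
  shows "card (span (insert y U)) = CARD('a) * card U"
proof -
  have "bij_betw (\<lambda>(c, u). scale c y + u) (UNIV \<times> U) (span (insert y U))"
    unfolding bij_betw_def
  proof
    show "inj_on (\<lambda>(c, u). scale c y + u) (UNIV \<times> U)"
    proof (rule inj_onI, clarify)
      fix c u d v assume u: "u \<in> U" and v: "v \<in> U" and eq: "scale c y + u = scale d y + v"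
      have e: "scale (c - d) y = v - u" using eq by (simp add: scale_left_diff_distrib algebra_simps)
      have "c = d"
      proof (rule ccontr)
        assume "c \<noteq> d"
        have "scale (inverse (c - d)) (scale (c - d) y) \<in> U"
          unfolding e using U u v by (intro subspace_scale subspace_diff)
        then show False using \<open>c \<noteq> d\<close> y by simp
      qed
      then show "c = d \<and> u = v" using eq by simp
    qed
    have "span U = U" using U by (simp add: span_eq_iff)
    then show "(\<lambda>(c, u). scale c y + u) ` (UNIV \<times> U) = span (insert y U)"
      unfolding span_insert
    proof (intro set_eqI iffI)
      fix z assume "z \<in> {z. \<exists>c. z - scale c y \<in> span U}"
      then obtain c where "z - scale c y \<in> U" using \<open>span U = U\<close> by auto
      then show "z \<in> (\<lambda>(c, u). scale c y + u) ` (UNIV \<times> U)"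
        by (intro image_eqI[of _ _ "(c, z - scale c y)"]) auto
    next
      fix z assume "z \<in> (\<lambda>(c, u). scale c y + u) ` (UNIV \<times> U)"
      then obtain c u where "z = scale c y + u" "u \<in> U" by auto
      then have "z - scale c y \<in> U" by simp
      then show "z \<in> {z. \<exists>c. z - scale c y \<in> span U}" by (auto intro: span_base)
    qed
  qed
  then show ?thesis using bij_betw_same_card by (fastforce simp: card_cartesian_product)
qed

lemma span_insert_zero: "span {y, 0} = span {y}"
  using span_insert_0[of "{y}"] insert_commute[of y 0 "{}"] by metis

lemma card_span_independent:
  assumes "finite B" and "independent B"
  shows "card (span B) = CARD('a) ^ card B"
  using assms
proof (induction B rule: finite_induct)
  case (insert y B)
  then have "y \<notin> span B" "independent B" by (auto simp: independent_insert)
  moreover have "span (insert y (span B)) = span (insert y B)"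
    by (simp add: span_insert span_span)
  ultimately show ?case using insert card_span_insert[of "span B" y] by simp
qed simp

text \<open>Steinitz exchange: \<open>z\<close> involves \<open>y\<close> with a nonzero
  coefficient, so \<open>y\<close> can be recovered from \<open>z\<close> and
  \<open>U\<close>.\<close>

lemma span_insert_cong:
  assumes U: "subspace U" and z: "z \<in> span (insert y U) - U"
  shows "span (insert z U) = span (insert y U)"
proof -
  have "z \<notin> span U" using U z by (metis DiffD2 span_eq_iff)
  then have "y \<in> span (insert z U)" using z in_span_insert[of z y U] by blast
  then show ?thesis using z unfolding span_eq by (auto intro: span_base)
qed

text \<open>The one-vector extensions of \<open>U\<close> inside \<open>W\<close>, with
  \<open>U\<close> removed from each, partition \<open>W - U\<close> into blocks of equal size. With
  \<open>U = {0}\<close> this counts lines, with \<open>U\<close> a line the planes through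
  it.\<close>

lemma card_covers:
  assumes U: "subspace U" and W: "subspace W" "finite W" and UW: "U \<subseteq> W"
  shows "card ((\<lambda>y. span (insert y U)) ` (W - U)) * (CARD('a) * card U - card U) = card W - card U"
proof -
  let ?s = "\<lambda>y. span (insert y U)"
  \<comment> \<open>By exchange, every vector of the extension outside \<open>U\<close> generates
    the same extension.\<close>
  have fib: "{z \<in> W - U. ?s z = ?s y} = ?s y - U" if y: "y \<in> W - U" for y
  proof -
    have "?s y \<subseteq> W" using y UW W by (intro span_minimal) auto
    then show ?thesis using span_insert_cong[OF U] by (auto intro: span_base)
  qed
  have "card (W - U) = (\<Sum>S\<in>?s ` (W - U). card {z \<in> W - U. ?s z = S})"
    using sum.image_gen[of "W - U" "\<lambda>_. 1::nat" ?s] W by simp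
  also have "\<dots> = (\<Sum>S\<in>?s ` (W - U). CARD('a) * card U - card U)"
  proof (rule sum.cong[OF refl])
    fix S assume "S \<in> ?s ` (W - U)"
    then obtain y where y: "y \<in> W - U" "S = ?s y" by blast
    have "card (?s y - U) = card (?s y) - card U"
      using UW W by (intro card_Diff_subset) (auto intro: span_base finite_subset)
    then show "card {z \<in> W - U. ?s z = S} = CARD('a) * card U - card U"
      using fib[OF y(1)] y U by (simp add: card_span_insert)
  qed
  finally show ?thesis using UW W by (simp add: card_Diff_subset finite_subset)
qed

end

lemma (in finite_dimensional_vector_space) card_subspace:
  assumes "subspace S"
  shows "card S = CARD('a) ^ dim S"
proof -
  obtain B where "B \<subseteq> S" "independent B" "S \<subseteq> span B" "card B = dim S"
    using basis_exists by blast
  then have "span B = S" using assms by (simp add: span_subspace)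
  then show ?thesis
    using card_span_independent[of B] \<open>independent B\<close> \<open>card B = dim S\<close> finiteI_independent by auto
qed


section \<open>Subalgebras of three-dimensional Lie algebras\<close>

context lie_algebra
begin

section \<open>Bracket identities\<close>

lemma bracket_zero_right [simp]: "bracket x 0 = 0"
  using bracket_add_right[of x 0 0] by simp

lemma bracket_minus_right: "bracket x (- y) = - bracket x y"
  using bracket_add_right[of x y "- y"] by (simp add: eq_neg_iff_add_eq_0 add.commute)

lemma bracket_commute: "bracket y x = - bracket x y"
  using bracket_self[of "x + y"]
  unfolding bracket_add_left bracket_add_right
  by (simp add: bracket_self eq_neg_iff_add_eq_0 add.commute)

text \<open>This is the Jacobi identity with signs rearranged: \<open>ad x\<close> is a
  derivation.\<close>

lemma bracket_leibniz: "bracket x (bracket y z) = bracket (bracket x y) z + bracket y (bracket x z)"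
  using jacobi[of x y z] bracket_commute[of z "bracket x y"] bracket_commute[of z x]
  by (simp add: bracket_minus_right algebra_simps eq_neg_iff_add_eq_0)

lemma bracket_in_derived: "bracket x y \<in> derived_algebra"
  unfolding derived_algebra_def by (rule span_base) auto

text \<open>The scalar is the determinant of the coefficients; in particular all brackets within
  \<open>span {u, v}\<close> are multiples of a single one.\<close>

lemma bracket_combination:
  "bracket (scale a u + scale b v) (scale c u + scale d v) = scale (a * d - b * c) (bracket u v)"
  using bracket_commute[of v u]
  by (simp add: bracket_add_left bracket_add_right bracket_scale_left bracket_scale_right
      bracket_self scale_left_diff_distrib mult.commute)

lemma subspace_derived: "subspace derived_algebra"
  by (simp add: derived_algebra_def subspace_span)

end

lemma (in vector_space) in_span_pair: "v \<in> span {u, w} \<longleftrightarrow> (\<exists>a b. v = scale a u + scale b w)"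
  by (auto simp: span_insert span_singleton diff_eq_eq add.commute)

locale finite_dimensional_lie_algebra =
  lie_algebra scale bracket + finite_dimensional_vector_space scale Basis
  for scale :: "'a::field \<Rightarrow> 'b::ab_group_add \<Rightarrow> 'b"
    and bracket :: "'b \<Rightarrow> 'b \<Rightarrow> 'b" and Basis :: "'b set"
begin

section \<open>Planes and the derived algebra as an abelian hyperplane\<close>

lemma plane_eq_span:
  assumes "subspace P" "dim P = 2" "u \<in> P" "v \<in> P" "u \<noteq> 0" "v \<notin> span {u}"
  shows "P = span {v, u}"
proof -
  have "span {v, u} \<subseteq> P" using assms by (intro span_minimal) auto
  moreover have "dim (span {v, u}) = 2" using assms by (simp add: dim_insert)
  ultimately show ?thesis
    using assms subspace_dim_equal[of "span {v, u}" P] by (simp add: subspace_span)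
qed

lemma plane_not_subset_span:
  assumes "dim P = 2"
  shows "\<not> P \<subseteq> span {u}"
  using subset_le_dim[of P "{u}"] assms by (auto split: if_splits)

lemma derived_complement:
  assumes "dim (UNIV :: 'b set) = 3" "dim derived_algebra = 2" "x \<notin> derived_algebra"
  obtains a v where "v \<in> derived_algebra" "y = scale a x + v"
proof -
  have sp: "span derived_algebra = derived_algebra"
    using subspace_derived by (simp add: span_eq_iff)
  have "dim (span (insert x derived_algebra)) = 3"
    using assms unfolding dim_span dim_insert sp by simp
  then have "span (insert x derived_algebra) = UNIV"
    using assms subspace_dim_equal[of _ UNIV] subspace_span subspace_UNIV by (simp del: dim_UNIV)
  then have "y \<in> span (insert x derived_algebra)" by simp
  then obtain a where "y - scale a x \<in> derived_algebra" unfolding span_insert sp by blast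
  then show ?thesis using that[of "y - scale a x" a] by simp
qed

text \<open>If \<open>w\<close> spanned a nonzero \<open>[V, V]\<close> for \<open>V = [L, L]\<close>, then \<open>[w, u] = c w\<close> with \<open>c \<noteq> 0\<close> for
  some \<open>u\<close> completing \<open>w\<close> to a basis of \<open>V\<close>, and the Leibniz rule for \<open>ad x\<close> on \<open>[w, u]\<close> would
  force \<open>[x, u]\<close> into the span of \<open>w\<close>; then \<open>[L, L]\<close> would be a line.\<close>

lemma derived_abelian:
  assumes d3: "dim (UNIV :: 'b set) = 3" and d2: "dim derived_algebra = 2"
    and u: "u \<in> derived_algebra" and v: "v \<in> derived_algebra"
  shows "bracket u v = 0"
proof (rule ccontr)
  assume nz: "bracket u v \<noteq> 0"
  define w where "w = bracket u v"
  have w: "w \<noteq> 0" "w \<in> derived_algebra" using nz bracket_in_derived by (auto simp: w_def)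
  have "u \<noteq> 0" using nz bracket_commute[of 0 v] by auto
  moreover have "v \<notin> span {u}" using nz by (auto simp: span_singleton bracket_scale_right bracket_self)
  ultimately have V: "derived_algebra = span {v, u}"
    using u v d2 subspace_derived by (intro plane_eq_span)
  have VV: "\<exists>c. bracket y z = scale c w" if yz: "y \<in> derived_algebra" "z \<in> derived_algebra" for y z
  proof -
    obtain a b c d where "y = scale a u + scale b v" "z = scale c u + scale d v"
      using yz unfolding V by (metis in_span_pair insert_commute)
    then show ?thesis using bracket_combination w_def by metis
  qed
  obtain t where t: "t \<in> derived_algebra" "t \<notin> span {w}"
    using plane_not_subset_span[OF d2] by blast
  have Vt: "derived_algebra = span {t, w}"
    using plane_eq_span[OF subspace_derived d2 w(2) t(1) w(1) t(2)] .
  have span_t: "\<exists>a b. y = scale a w + scale b t" if "y \<in> derived_algebra" for y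
    using that unfolding Vt by (metis in_span_pair insert_commute)
  obtain c where c: "bracket w t = scale c w" using VV w t by blast
  \<comment> \<open>Since \<open>w\<close> and \<open>t\<close> span the derived algebra,
    \<open>c = 0\<close> would make all brackets inside it vanish.\<close>
  have "c \<noteq> 0"
  proof
    assume "c = 0"
    obtain a b a' b' where "u = scale a w + scale b t" "v = scale a' w + scale b' t"
      using span_t u v by blast
    then show False using nz bracket_combination c \<open>c = 0\<close> by simp
  qed
  obtain x where x: "x \<notin> derived_algebra"
    using d3 d2 by (metis UNIV_eq_I numeral_eq_iff semiring_norm(89))
  \<comment> \<open>As a derivation, \<open>ad x\<close> maps \<open>w\<close>, a bracket of
    elements of the derived algebra, to a sum of two such brackets, hence to a multiple of
    \<open>w\<close>.\<close>
  obtain k l where "bracket (bracket x u) v = scale k w" "bracket u (bracket x v) = scale l w"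
    using VV u v bracket_in_derived by metis
  then have xw: "bracket x w = scale (k + l) w"
    using bracket_leibniz[of x u v] by (simp add: w_def scale_left_distrib)
  obtain m n where xt: "bracket x t = scale m w + scale n t"
    using span_t bracket_in_derived by blast
  \<comment> \<open>The left side is \<open>c * (k + l)\<close> times \<open>w\<close>, and the
    right side exceeds it by \<open>n * c\<close> times \<open>w\<close>.\<close>
  have "bracket x (bracket w t) = bracket (bracket x w) t + bracket w (bracket x t)"
    by (rule bracket_leibniz)
  then have "scale (n * c) w = 0"
    unfolding c xw xt by (simp add: bracket_add_right bracket_scale_left bracket_scale_right
        bracket_self c xw mult.commute)
  then have "n = 0" using w \<open>c \<noteq> 0\<close> by simp
  have xV: "bracket x y \<in> span {w}" if y: "y \<in> derived_algebra" for y
  proof -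
    obtain a b where "y = scale a w + scale b t" using span_t[OF y] by blast
    then show ?thesis unfolding span_singleton
      by (auto simp: bracket_add_right bracket_scale_right xw xt \<open>n = 0\<close>
          simp flip: scale_left_distrib)
  qed
  have "bracket y z \<in> span {w}" for y z
  proof -
    obtain a y' where y: "y' \<in> derived_algebra" "y = scale a x + y'"
      using derived_complement[OF d3 d2 x] .
    obtain b z' where z: "z' \<in> derived_algebra" "z = scale b x + z'"
      using derived_complement[OF d3 d2 x] .
    have "bracket y' z' \<in> span {w}" using VV[OF y(1) z(1)] by (auto simp: span_singleton)
    moreover have "bracket y z = scale a (bracket x z') - scale b (bracket x y') + bracket y' z'"
      unfolding y z using bracket_commute[of y' x]
      by (simp add: bracket_add_left bracket_add_right bracket_scale_left bracket_scale_right
          bracket_self algebra_simps)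
    ultimately show ?thesis using xV y z by (auto intro!: span_add span_diff span_scale)
  qed
  then have "derived_algebra \<subseteq> span {w}"
    unfolding derived_algebra_def by (intro span_minimal) (auto simp: subspace_span)
  then show False using plane_not_subset_span[OF d2] by blast
qed

text \<open>A plane \<open>P\<close> other than the derived algebra meets it in a line and contains
  some \<open>p\<close> outside it. As the derived algebra is abelian, \<open>p\<close> acts on it
  as a nonzero multiple of \<open>ad x\<close>, so \<open>P\<close> is closed exactly when that line
  is invariant under \<open>ad x\<close>. The only invariant line is
  \<open>span {e}\<close>.\<close>

lemma plane_subalgebra_iff:
  assumes d3: "dim (UNIV :: 'b set) = 3" and d2: "dim derived_algebra = 2"
    and x: "x \<notin> derived_algebra"
    and e: "e \<in> derived_algebra" "e \<noteq> 0" "bracket x e = scale l e"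
    and unique: "\<And>v c. v \<in> derived_algebra \<Longrightarrow> bracket x v = scale c v \<Longrightarrow> v \<in> span {e}"
    and P: "subspace P" "dim P = 2"
  shows "lie_subalgebra P \<longleftrightarrow> e \<in> P"
proof (cases "P = derived_algebra")
  case True
  then show ?thesis using P e bracket_in_derived by (auto simp: lie_subalgebra_def)
next
  case False
  then obtain p where p: "p \<in> P" "p \<notin> derived_algebra"
    using P d2 subspace_dim_equal[of P derived_algebra] subspace_derived by auto
  obtain k p' where k: "p' \<in> derived_algebra" "p = scale k x + p'"
    using derived_complement[OF d3 d2 x] .
  have "k \<noteq> 0" using k p by auto
  have pv: "bracket p v = scale k (bracket x v)" if "v \<in> derived_algebra" for v
    using k that derived_abelian[OF d3 d2] by (simp add: bracket_add_left bracket_scale_left)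
  show ?thesis
  proof
    assume "e \<in> P"
    have "span {e} \<subseteq> derived_algebra" using e subspace_derived by (intro span_minimal) auto
    then have "P = span {p, e}" using P p e \<open>e \<in> P\<close> by (intro plane_eq_span) auto
    moreover have "bracket p e \<in> P" using pv[OF e(1)] e \<open>e \<in> P\<close> P by (auto intro!: subspace_scale)
    \<comment> \<open>All brackets within \<open>span {p, e}\<close> are multiples of the bracket of
      \<open>p\<close> and \<open>e\<close>.\<close>
    ultimately have "bracket y z \<in> P" if "y \<in> P" "z \<in> P" for y z
      using that P bracket_combination unfolding in_span_pair by (metis in_span_pair subspace_scale)
    then show "lie_subalgebra P" using P by (simp add: lie_subalgebra_def)
  next
    assume closed: "lie_subalgebra P"
    obtain r where r: "r \<in> P" "r \<notin> span {p}" using plane_not_subset_span[OF P(2)] by blast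
    obtain a r' where a: "r' \<in> derived_algebra" "r = scale a x + r'"
      using derived_complement[OF d3 d2 x] .
    \<comment> \<open>The multiple of \<open>p\<close> is chosen to cancel the
      \<open>x\<close>-component \<open>a\<close> of \<open>r\<close>, so that \<open>v\<close> lies
      in both \<open>P\<close> and the derived algebra.\<close>
    define v where "v = r - scale (a / k) p"
    have "v \<in> P" using r p P by (auto simp: v_def intro!: subspace_diff subspace_scale)
    have "v = r' - scale (a / k) p'"
      using \<open>k \<noteq> 0\<close> by (simp add: v_def a k scale_right_distrib)
    then have vV: "v \<in> derived_algebra"
      using a k subspace_derived by (auto intro!: subspace_diff subspace_scale)
    have "v \<noteq> 0" using r by (auto simp: v_def span_singleton)
    \<comment> \<open>Two distinct planes share no more than a line, here the one spanned by
      \<open>v\<close>.\<close>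
    have inter: "u \<in> span {v}" if "u \<in> P" "u \<in> derived_algebra" for u
    proof (rule ccontr)
      assume "u \<notin> span {v}"
      then have "P = span {u, v}" "derived_algebra = span {u, v}"
        using plane_eq_span P d2 subspace_derived \<open>v \<in> P\<close> vV \<open>v \<noteq> 0\<close> that by blast+
      then show False using False by simp
    qed
    have "bracket p v \<in> span {v}"
      using closed p \<open>v \<in> P\<close> bracket_in_derived by (intro inter) (auto simp: lie_subalgebra_def)
    then obtain c where "scale k (bracket x v) = scale c v"
      unfolding pv[OF vV] by (auto simp: span_singleton)
    then have "scale (1 / k) (scale k (bracket x v)) = scale (1 / k) (scale c v)" by simp
    then have "bracket x v = scale (c / k) v" using \<open>k \<noteq> 0\<close> by simp
    then have "v \<in> span {e}" using unique vV by blast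
    then obtain d where d: "v = scale d e" by (auto simp: span_singleton)
    then have "d \<noteq> 0" using \<open>v \<noteq> 0\<close> by auto
    then have "e = scale (1 / d) v" using d by simp
    then show "e \<in> P" using \<open>v \<in> P\<close> P by (auto intro!: subspace_scale)
  qed
qed

end

section \<open>Planes through a fixed line\<close>

text \<open>The count depends on the bracket only through \<open>plane_iff\<close>; the derived
  algebra and \<open>ad x\<close> serve to establish it and do not enter the counting.\<close>

locale pencil_lie_algebra = finite_dimensional_lie_algebra scale bracket Basis
  for scale :: "'a::{field,finite} \<Rightarrow> 'b::ab_group_add \<Rightarrow> 'b"
    and bracket :: "'b \<Rightarrow> 'b \<Rightarrow> 'b" and Basis :: "'b set" +
  fixes e :: 'b
  assumes dim3: "dim (UNIV :: 'b set) = 3"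
    and nonzero: "e \<noteq> 0"
    and plane_iff: "subspace P \<Longrightarrow> dim P = 2 \<Longrightarrow> lie_subalgebra P \<longleftrightarrow> e \<in> P"
begin

text \<open>This names the part to which a vertex belongs: a plane containing \<open>e\<close> is
  its own image, and a line other than \<open>span {e}\<close> is sent to the plane it spans with
  \<open>e\<close>.\<close>

definition plane_through :: "'b set \<Rightarrow> 'b set" where
  "plane_through A = span (insert e A)"

definition non_isolated :: "'b set set" where
  "non_isolated = comaximal_vertices - {span {e}}"

section \<open>Vertices and the planes through \<open>e\<close>\<close>

lemma finite_space: "finite (UNIV :: 'b set)"
  using card_subspace[OF subspace_UNIV] dim3 by (simp add: card_ge_0_finite)

lemma one_less_card_field: "1 < CARD('a)"
  using card_mono[of UNIV "{0, 1 :: 'a}"] by simp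

lemma dim_proper:
  assumes "subspace A" "A \<noteq> {0}" "A \<noteq> UNIV"
  shows "dim A = 1 \<or> dim A = 2"
proof -
  have "dim A \<noteq> 0" using assms subspace_0 by auto
  moreover have "dim A < 3"
    using assms subspace_dim_equal[of A UNIV] dim3 subspace_UNIV by (fastforce simp del: dim_UNIV)
  ultimately show ?thesis by linarith
qed

lemma subspace_dim_1:
  assumes "subspace A" "dim A = 1" "v \<in> A" "v \<noteq> 0"
  shows "A = span {v}"
  using assms subspace_dim_equal[of "span {v}" A] span_minimal[of "{v}" A]
  by (simp add: subspace_span)

lemma vertexD:
  assumes "A \<in> comaximal_vertices"
  shows "subspace A" "lie_subalgebra A" "dim A = 1 \<or> dim A = 2"
  using assms dim_proper[of A] by (auto simp: comaximal_vertices_def lie_subalgebra_def)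

lemma vertexI:
  assumes "lie_subalgebra A" "dim A = 1 \<or> dim A = 2"
  shows "A \<in> comaximal_vertices"
proof -
  have "dim {0} = 0" by simp
  then have "A \<noteq> {0}" "A \<noteq> UNIV" using assms dim3 by auto
  then show ?thesis using assms by (simp add: comaximal_vertices_def)
qed

lemma lie_subalgebra_line: "lie_subalgebra (span {v})"
  unfolding lie_subalgebra_def using subspace_span[of "{v}"]
  by (auto simp: span_singleton bracket_scale_left bracket_scale_right bracket_self)

text \<open>A line containing \<open>e\<close> is the excluded vertex \<open>span {e}\<close>, and a
  plane avoiding \<open>e\<close> is not a subalgebra.\<close>

lemma non_isolated_cases:
  assumes "A \<in> non_isolated"
  shows "e \<in> A \<and> dim A = 2 \<and> plane_through A = A
    \<or> e \<notin> A \<and> dim A = 1 \<and> dim (plane_through A) = 2"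
proof -
  have A: "A \<in> comaximal_vertices" "A \<noteq> span {e}" using assms by (auto simp: non_isolated_def)
  note * = vertexD[OF A(1)]
  have sp: "span A = A" using * by (simp add: span_eq_iff)
  show ?thesis
  proof (cases "e \<in> A")
    case True
    then have "dim A \<noteq> 1" using subspace_dim_1[of A e] * A nonzero by blast
    then show ?thesis using True * sp by (auto simp: plane_through_def insert_absorb)
  next
    case False
    then have "dim A \<noteq> 2" using plane_iff * by blast
    then have "dim A = 1" using * by blast
    moreover have "dim (plane_through A) = dim A + 1"
      using False unfolding plane_through_def dim_span dim_insert sp by simp
    ultimately show ?thesis using False by simp
  qed
qed

lemma plane_through_plane:
  assumes "A \<in> non_isolated"
  shows "subspace (plane_through A)" "dim (plane_through A) = 2" "e \<in> plane_through A"
    "A \<subseteq> plane_through A"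
  using non_isolated_cases[OF assms]
  by (auto simp: plane_through_def subspace_span insert_absorb intro: span_base)

text \<open>Each plane through \<open>e\<close> is itself a vertex and is fixed by
  \<open>plane_through\<close>, so these planes index the parts.\<close>

lemma planes_eq: "plane_through ` non_isolated = {P. subspace P \<and> dim P = 2 \<and> e \<in> P}"
proof (intro set_eqI iffI)
  fix P assume "P \<in> {P. subspace P \<and> dim P = 2 \<and> e \<in> P}"
  then have P: "subspace P" "dim P = 2" "e \<in> P" by auto
  then have "P \<in> comaximal_vertices" using vertexI plane_iff by blast
  moreover have "dim (span {e}) = 1" using nonzero by simp
  ultimately have "P \<in> non_isolated" using P by (auto simp: non_isolated_def)
  moreover have "plane_through P = P" using non_isolated_cases[OF calculation] P by blast
  ultimately show "P \<in> plane_through ` non_isolated" by (metis imageI)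
qed (auto simp: plane_through_plane)

section \<open>Adjacency\<close>

lemma lie_generated_subset:
  "X \<subseteq> P \<Longrightarrow> lie_subalgebra P \<Longrightarrow> lie_generated X \<subseteq> P"
  by (simp add: lie_generated_def hull_minimal)

lemma lie_generated_eq_UNIV_iff:
  assumes A: "A \<in> comaximal_vertices" and B: "B \<in> comaximal_vertices" and "A \<noteq> B"
  shows "lie_generated (A \<union> B) = UNIV \<longleftrightarrow>
    A \<in> non_isolated \<and> B \<in> non_isolated \<and> plane_through A \<noteq> plane_through B"
proof -
  \<comment> \<open>A plane through \<open>e\<close> is a proper subalgebra and traps everything
    generated inside it. This handles both pairs containing \<open>span {e}\<close> and pairs with a
    common plane.\<close>
  have small: "lie_generated (A' \<union> B') \<noteq> UNIV"
    if P: "P \<in> plane_through ` non_isolated" and "A' \<subseteq> P" "B' \<subseteq> P" for P A' B'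
  proof -
    have *: "subspace P" "dim P = 2" "e \<in> P" using P unfolding planes_eq by auto
    then have "lie_generated (A' \<union> B') \<subseteq> P"
      using that plane_iff by (intro lie_generated_subset) auto
    then show ?thesis using * dim3 by (metis UNIV_I numeral_eq_iff semiring_norm(89) subset_antisym subset_UNIV)
  qed
  have eC: "span {e} \<subseteq> plane_through C" if "C \<in> non_isolated" for C
    using plane_through_plane[OF that] by (intro span_minimal) auto
  show ?thesis
  proof (cases "A \<in> non_isolated \<and> B \<in> non_isolated")
    case False
    then have "A = span {e} \<and> B \<in> non_isolated \<or> B = span {e} \<and> A \<in> non_isolated"
      using assms by (auto simp: non_isolated_def)
    then have "lie_generated (A \<union> B) \<noteq> UNIV"
      using small eC plane_through_plane(4) by (metis imageI)
    then show ?thesis using False by blast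
  next
    case True
    let ?M = "lie_generated (A \<union> B)"
    have M: "lie_subalgebra ?M" by (rule lie_subalgebra_generated)
    then have sM: "subspace ?M" by (simp add: lie_subalgebra_def)
    have AB: "A \<subseteq> ?M" "B \<subseteq> ?M" using hull_subset[of "A \<union> B" lie_subalgebra]
      by (auto simp: lie_generated_def)
    have "plane_through A = plane_through B" if proper: "?M \<noteq> UNIV"
    proof -
      have "?M \<noteq> {0}" using AB A subspace_0[of A] vertexD[of A]
        by (auto simp: comaximal_vertices_def)
      then have Mv: "?M \<in> comaximal_vertices" using M proper by (simp add: comaximal_vertices_def)
      \<comment> \<open>A proper subalgebra avoiding \<open>e\<close> is a line, and two distinct
        vertices do not fit into one line.\<close>
      have "e \<in> ?M"
      proof (rule ccontr)
        assume "e \<notin> ?M"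
        then have "dim ?M = 1" using plane_iff M sM vertexD[OF Mv] by blast
        moreover have "1 \<le> dim A" "1 \<le> dim B"
          using vertexD(3)[OF A] vertexD(3)[OF B] by auto
        ultimately have "A = ?M" "B = ?M"
          using AB vertexD(1) A B sM subspace_dim_equal by auto
        then show False using \<open>A \<noteq> B\<close> by blast
      qed
      then have "plane_through A \<subseteq> ?M" "plane_through B \<subseteq> ?M"
        using AB sM span_minimal[of "insert e A" ?M] span_minimal[of "insert e B" ?M]
        unfolding plane_through_def by auto
      \<comment> \<open>Both planes lie in \<open>?M\<close>, which has no room for more than
        one.\<close>
      moreover have "dim ?M \<le> 2" using vertexD[OF Mv] by auto
      ultimately show ?thesis using subspace_dim_equal[OF _ sM] plane_through_plane True by metis
    qed
    moreover have "?M \<noteq> UNIV" if "plane_through A = plane_through B"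
      using small[of "plane_through A" A B] plane_through_plane(4) True that by blast
    ultimately show ?thesis using True by blast
  qed
qed

section \<open>Number and size of the parts\<close>

lemma card_planes: "card (plane_through ` non_isolated) = CARD('a) + 1"
proof -
  let ?E = "span {e}" and ?q = "CARD('a)"
  \<comment> \<open>In this form the planes are the one-vector extensions of the line
    \<open>?E\<close>, to which \<open>card_covers\<close> applies.\<close>
  have "plane_through ` non_isolated = (\<lambda>y. span (insert y ?E)) ` (UNIV - ?E)"
    unfolding planes_eq
  proof (intro set_eqI iffI)
    fix P assume "P \<in> {P. subspace P \<and> dim P = 2 \<and> e \<in> P}"
    then have P: "subspace P" "dim P = 2" "e \<in> P" by auto
    have EP: "?E \<subseteq> P" using P by (intro span_minimal) auto
    moreover have "dim ?E = 1" using nonzero by simp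
    ultimately have "P \<noteq> ?E" using P(2) by auto
    then obtain y where y: "y \<in> P" "y \<notin> ?E" using EP by blast
    have "span (insert y ?E) \<subseteq> P" using EP y P by (intro span_minimal) auto
    moreover have "dim (span (insert y ?E)) = 2"
      using y nonzero by (simp add: dim_insert span_span)
    ultimately have "span (insert y ?E) = P"
      using P subspace_dim_equal[of _ P] by (simp add: subspace_span)
    then show "P \<in> (\<lambda>y. span (insert y ?E)) ` (UNIV - ?E)" using y by blast
  next
    fix P assume "P \<in> (\<lambda>y. span (insert y ?E)) ` (UNIV - ?E)"
    then obtain y where y: "y \<notin> ?E" "P = span (insert y ?E)" by blast
    then show "P \<in> {P. subspace P \<and> dim P = 2 \<and> e \<in> P}"
      using nonzero by (auto simp: dim_insert span_span subspace_span intro: span_base)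
  qed
  moreover have "card ?E = ?q" using card_subspace[of ?E] nonzero by (simp add: subspace_span)
  moreover have "card (UNIV :: 'b set) = ?q ^ 3"
    using card_subspace[OF subspace_UNIV] dim3 by simp
  ultimately have "card (plane_through ` non_isolated) * (?q * ?q - ?q) = ?q ^ 3 - ?q"
    using card_covers[of ?E UNIV] finite_space by (simp add: subspace_span subspace_UNIV)
  also have "\<dots> = (?q + 1) * (?q * ?q - ?q)"
    by (simp add: power3_eq_cube algebra_simps)
  finally show ?thesis using one_less_card_field by (subst (asm) mult_right_cancel) auto
qed

text \<open>The part of \<open>P\<close> consists of \<open>P\<close> itself and its lines other
  than \<open>span {e}\<close>. There are \<open>CARD('a) + 1\<close> lines in \<open>P\<close>, so
  adding \<open>P\<close> makes up for the line removed.\<close>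

lemma card_part:
  assumes P: "P \<in> plane_through ` non_isolated"
  shows "card {A \<in> non_isolated. plane_through A = P} = CARD('a) + 1"
proof -
  let ?q = "CARD('a)" and ?lines = "(\<lambda>y. span {y}) ` (P - {0})"
  have sP: "subspace P" "dim P = 2" "e \<in> P" using P unfolding planes_eq by auto
  have lines: "dim l = 1" if "l \<in> ?lines" for l
    using that by (auto split: if_splits)
  have "{A \<in> non_isolated. plane_through A = P} = insert P (?lines - {span {e}})"
  proof (intro set_eqI iffI)
    fix A assume "A \<in> {A \<in> non_isolated. plane_through A = P}"
    then have A: "A \<in> non_isolated" "plane_through A = P" by auto
    show "A \<in> insert P (?lines - {span {e}})"
    proof (cases "e \<in> A")
      case True then show ?thesis using non_isolated_cases A by auto
    next
      case False
      then have "dim A = 1" "subspace A"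
        using non_isolated_cases A vertexD(1) by (auto simp: non_isolated_def)
      then obtain v where v: "v \<in> A" "v \<noteq> 0"
        using dim_eq_0[of A] by (metis singletonI subsetI zero_neq_one)
      then have "A = span {v}" using subspace_dim_1 \<open>dim A = 1\<close> \<open>subspace A\<close> by blast
      moreover have "v \<in> P" using v A plane_through_plane(4) by blast
      ultimately show ?thesis using v A(1) by (auto simp: non_isolated_def)
    qed
  next
    fix A assume A: "A \<in> insert P (?lines - {span {e}})"
    show "A \<in> {A \<in> non_isolated. plane_through A = P}"
    proof (cases "A = P")
      case True
      have "P \<in> comaximal_vertices" using sP vertexI plane_iff by blast
      moreover have "dim (span {e}) = 1" using nonzero by simp
      ultimately have "P \<in> non_isolated" using sP by (auto simp: non_isolated_def)
      then show ?thesis using True non_isolated_cases sP by blast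
    next
      case False
      then obtain y where y: "y \<in> P" "y \<noteq> 0" "A = span {y}" "A \<noteq> span {e}"
        using A by auto
      then have *: "A \<in> non_isolated"
        using vertexI[of A] lie_subalgebra_line by (auto simp: non_isolated_def)
      have "A \<subseteq> P" unfolding y(3) using y(1) sP(1) by (intro span_minimal) auto
      then have "plane_through A \<subseteq> P"
        using sP unfolding plane_through_def by (intro span_minimal) auto
      then have "plane_through A = P"
        using plane_through_plane[OF *] sP by (intro subspace_dim_equal) auto
      then show ?thesis using * by blast
    qed
  qed
  moreover have "card ?lines = ?q + 1"
  proof -
    have "card P = ?q * ?q" using card_subspace[OF sP(1)] sP by (simp add: power2_eq_square)
    \<comment> \<open>The lines of \<open>P\<close> are the one-vector extensions of
      \<open>{0}\<close>.\<close>
    then have "card ?lines * (?q - 1) = ?q * ?q - 1"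
      using card_covers[of "{0}" P] sP finite_space subspace_0[of P]
      by (simp add: subspace_single_0 span_insert_zero finite_subset[OF subset_UNIV])
    also have "\<dots> = (?q + 1) * (?q - 1)"
      by (simp add: algebra_simps)
    finally show ?thesis using one_less_card_field by (subst (asm) mult_right_cancel) auto
  qed
  moreover have "span {e} \<in> ?lines" using sP nonzero by auto
  moreover have "P \<notin> ?lines" using lines sP by force
  moreover have "finite ?lines" using finite_space by (simp add: finite_subset[OF subset_UNIV])
  ultimately show ?thesis by simp
qed

lemma num_triangles_comaximal_graph:
  "num_triangles comaximal_graph = (CARD('a) + 1 choose 3) * (CARD('a) + 1) ^ 3"
proof -
  have "finite (UNIV :: 'b set set)" using finite_space by (simp add: Finite_Set.finite_set)
  then have "num_triangles comaximal_graph
    = (card (plane_through ` non_isolated) choose 3) * (CARD('a) + 1) ^ 3"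
  proof (intro num_triangles_multipartite)
    show "{A, B} \<in> snd comaximal_graph \<longleftrightarrow>
        A \<in> non_isolated \<and> B \<in> non_isolated \<and> plane_through A \<noteq> plane_through B"
      if "A \<noteq> B" for A B
    proof -
      have "{A, B} \<in> snd comaximal_graph \<longleftrightarrow> A \<in> comaximal_vertices \<and> B \<in> comaximal_vertices
          \<and> lie_generated (A \<union> B) = UNIV"
        using that by (auto simp: comaximal_graph_def doubleton_eq_iff Un_commute)
      then show ?thesis
        using lie_generated_eq_UNIV_iff that by (auto simp: non_isolated_def)
    qed
    show "card {A \<in> non_isolated. plane_through A = P} = CARD('a) + 1"
      if "P \<in> plane_through ` non_isolated" for P using that by (rule card_part)
  qed (auto simp: non_isolated_def comaximal_graph_def intro: finite_subset[OF subset_UNIV])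
  then show ?thesis by (simp add: card_planes)
qed

end

text \<open>Stated over the reals, where the factor \<open>real n - 1\<close> is not truncated at
  \<open>n = 0\<close>.\<close>

lemma real_binomial_3: "real (n + 1 choose 3) = real n * (real n - 1) * (real n + 1) / 6"
  unfolding binomial_gbinomial gbinomial_prod_rev
  by (simp add: numeral_3_eq_3 fact_numeral)

theorem proposition3p9:
  fixes scale :: "'a::{field,finite} \<Rightarrow> 'b::ab_group_add \<Rightarrow> 'b"
    and bracket :: "'b \<Rightarrow> 'b \<Rightarrow> 'b"
    and V :: "'b set"
    and q :: nat
  assumes "lie_algebra scale bracket"
    and "q = CARD('a)"
    and "vector_space.dim scale (UNIV :: 'b set) = 3"
    and "V = lie_algebra.derived_algebra scale bracket"
    and "vector_space.dim scale V = 2"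
    and "\<exists>x. x \<notin> V
           \<and> (\<exists>!c. vector_space.eigenvalue_on scale V (lie_algebra.ad bracket x) c)
           \<and> \<not> vector_space.diagonalisable_on scale V (lie_algebra.ad bracket x)"
  shows "real (num_triangles (lie_algebra.comaximal_graph scale bracket)) =
           real q * (real q - 1) * (real q + 1) ^ 4 / 6"
proof -
  interpret lie_algebra scale bracket by fact
  obtain B where B: "independent B" "span B = UNIV" "card B = 3"
    using basis_exists[of UNIV] assms(3) by (metis top.extremum_uniqueI)
  \<comment> \<open>An infinite set has \<open>card\<close> 0, so cardinality 3 forces
    finiteness.\<close>
  then have "finite B" by (intro card_ge_0_finite) simp
  interpret finite_dimensional_lie_algebra scale bracket B
    using B \<open>finite B\<close> by unfold_locales
  have d3: "dim (UNIV :: 'b set) = 3" and d2: "dim derived_algebra = 2"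
    using assms by simp_all
  obtain x where x: "x \<notin> derived_algebra" "\<exists>c. eigenvalue_on derived_algebra (ad x) c"
      "\<not> diagonalisable_on derived_algebra (ad x)"
    using assms by auto
  then obtain e l where e: "e \<in> derived_algebra" "e \<noteq> 0" "bracket x e = scale l e"
    by (auto simp: eigenvalue_on_def ad_def)
  \<comment> \<open>An eigenvector outside \<open>span {e}\<close>, for whatever eigenvalue, would
    complete \<open>e\<close> to an eigenbasis, contradicting non-diagonalisability.\<close>
  have unique: "v \<in> span {e}" if v: "v \<in> derived_algebra" "bracket x v = scale c v" for v c
  proof (rule ccontr)
    assume "v \<notin> span {e}"
    moreover from this have "derived_algebra = span {v, e}"
      using v e d2 subspace_derived by (intro plane_eq_span)
    ultimately have "diagonalisable_on derived_algebra (ad x)"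
      unfolding diagonalisable_on_def using v e
      by (intro exI[of _ "{v, e}"]) (auto simp: ad_def independent_insert)
    then show False using x by blast
  qed
  interpret pencil_lie_algebra scale bracket B e
    by unfold_locales (fact d3, fact e(2), rule plane_subalgebra_iff[OF d3 d2 x(1) e unique])
  show ?thesis
    unfolding num_triangles_comaximal_graph of_nat_mult real_binomial_3
    using assms(2) by (simp add: power_numeral_reduce field_simps)
qed

end
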